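(* Let $\mathcal G=(\mathcal V,\mathcal E)$ be a simple directed graph (no self-loops) on $\mathcal V=\{1,\dots,n\}$ in which every node has out-degree at least one. Let $\bm A$ be its adjacency matrix, $\bm D=\mathrm{diag}(d_1,\dots,d_n)$ its out-degree matrix, and let $\alpha\in(0,1)$, $\epsilon>0$, $s\in\mathcal V$. Put $\bm M=\bm I-(1-\alpha)\bm A^\top\bm D^{-1}$ and $\bm b=\alpha\bm e_s$. Run the \textsc{FwdPush} procedure (defined in the context) from $\bm x=\bm 0$, $\bm r=\bm e_s$. Then every single push step of \textsc{FwdPush} at a node $u$ (which changes $\bm x$ only in coordinate $u$, via $x_u\leftarrow x_u+\alpha r_u$) is exactly one Gauss–Seidel coordinate update for the linear system $\bm M\bm x=\bm b$ at coordinate $u$, i.e. the new value of $x_u$ equals $\frac{1}{m_{uu}}\big(b_u-\sum_{j\neq u} m_{uj}x_j\big)$ evaluated at the current values $x_j$ of the other coordinates, and all other coordinates are left unchanged. Furthermore, the set of coordinates updated in the $t$-th Gauss–Seidel super-iteration $\mathcal S_t$ corresponds to the set of active nodes processed by \textsc{FwdPush} in its $t$-th epoch.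
   Context: \textsc{FwdPush}$(\mathcal G,\epsilon,\alpha,s)$: maintain an estimation vector $\bm x$ (initially $\bm 0$), a residual vector $\bm r$ (initially $\bm e_s$) and a FIFO queue $\mathcal Q$ (initially $[s]$). A node $u$ is active if $r_u\ge \epsilon d_u$. While $\mathcal Q\neq\emptyset$: pop $u$; set $x_u\leftarrow x_u+\alpha r_u$; for each out-neighbor $v$ of $u$, set $r_v\leftarrow r_v+(1-\alpha)r_u/d_u$ and, if $r_v\ge\epsilon d_v$ and $v\notin\mathcal Q$, push $v$ onto $\mathcal Q$; finally set $r_u\leftarrow 0$. Return $\bm x$. Epochs: imagine a dummy marker kept at the end of $\mathcal Q$; an epoch ends each time the marker is popped (and it is re-appended), so the $t$-th epoch processes exactly the active nodes present in the queue at its beginning, while nodes that become active during it are processed in the next epoch. The Gauss–Seidel iteration for $\bm M\bm x=\bm b$ updates, in super-iteration $t$, coordinates $u\in\mathcal S_t$ one at a time by $x_u\leftarrow \frac{1}{m_{uu}}\big(b_u-\sum_{j\neq u}m_{uj}x_j\big)$ using the most recent values of the other coordinates (standard Gauss–Seidel has $\mathcal S_t=\mathcal V$). *)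

theory Defs
  imports "HOL-Analysis.Analysis"
begin

section \<open>The linear system\<close>

text \<open>The vertex set is the whole finite type \<open>'n\<close>, and \<open>E\<close> is the set of directed edges.\<close>

definition out_deg :: "('n::finite \<times> 'n) set \<Rightarrow> 'n \<Rightarrow> nat" where
  "out_deg E u = card (E `` {u})"

definition adj_matrix :: "('n::finite \<times> 'n) set \<Rightarrow> real^'n^'n" where
  "adj_matrix E = (\<chi> i j. if (i, j) \<in> E then 1 else 0)"

definition deg_matrix :: "('n::finite \<times> 'n) set \<Rightarrow> real^'n^'n" where
  "deg_matrix E = (\<chi> i j. if i = j then real (out_deg E i) else 0)"

definition ppr_matrix :: "('n::finite \<times> 'n) set \<Rightarrow> real \<Rightarrow> real^'n^'n" where
  "ppr_matrix E \<alpha> = mat 1 - (1 - \<alpha>) *\<^sub>R (transpose (adj_matrix E) ** matrix_inv (deg_matrix E))"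

definition ppr_rhs :: "real \<Rightarrow> 'n::finite \<Rightarrow> real^'n" where
  "ppr_rhs \<alpha> s = \<alpha> *\<^sub>R axis s 1"


section \<open>Gauss--Seidel with prescribed coordinate sets\<close>

definition vec_upd :: "real^'n \<Rightarrow> 'n::finite \<Rightarrow> real \<Rightarrow> real^'n" where
  "vec_upd x u c = (\<chi> i. if i = u then c else x $ i)"

definition gs_update :: "real^'n^'n \<Rightarrow> real^'n \<Rightarrow> 'n::finite \<Rightarrow> real^'n \<Rightarrow> real^'n" where
  "gs_update M b u x =
     vec_upd x u (1 / M $ u $ u * (b $ u - (\<Sum>j\<in>UNIV - {u}. M $ u $ j * x $ j)))"

text \<open>
  \<open>X 0, \<dots>, X T\<close> are the iterates, starting from \<open>x0\<close>, of \<open>T\<close> super-iterations.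
  Super-iteration \<open>t\<close> (counted from \<open>0\<close>) updates every coordinate in \<open>S t\<close> exactly once, one at a
  time, in the order \<open>us t\<close>.
\<close>

definition gauss_seidel ::
  "real^'n^'n \<Rightarrow> real^'n \<Rightarrow> real^'n \<Rightarrow> nat \<Rightarrow> (nat \<Rightarrow> 'n::finite set) \<Rightarrow> (nat \<Rightarrow> 'n list) \<Rightarrow>
   (nat \<Rightarrow> real^'n) \<Rightarrow> bool" where
  "gauss_seidel M b x0 T S us X \<longleftrightarrow>
     X 0 = x0 \<and>
     (\<forall>t<T. distinct (us t) \<and> set (us t) = S t \<and> X (Suc t) = fold (gs_update M b) (us t) (X t))"


section \<open>FwdPush\<close>

text \<open>
  The entries of the queue are of type \<open>'n\<close> for the procedure itself, and of type \<open>'n option\<close> when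
  the queue also holds the epoch marker \<open>None\<close>.
\<close>

datatype ('n::finite, 'q) push_state =
  State (est: "real^'n") (res: "real^'n") (queue: "'q list")

definition active :: "('n::finite \<times> 'n) set \<Rightarrow> real \<Rightarrow> ('n, 'q) push_state \<Rightarrow> 'n \<Rightarrow> bool" where
  "active E \<epsilon> \<sigma> u \<longleftrightarrow> res \<sigma> $ u \<ge> \<epsilon> * real (out_deg E u)"

definition initial_state :: "'n::finite \<Rightarrow> ('n, 'n) push_state" where
  "initial_state s = State 0 (axis s 1) [s]"

definition relax ::
  "('n::finite \<times> 'n) set \<Rightarrow> real \<Rightarrow> real \<Rightarrow> 'n \<Rightarrow> 'n \<Rightarrow> (real^'n) \<times> 'n list \<Rightarrow> (real^'n) \<times> 'n list" where
  "relax E \<alpha> \<epsilon> u v = (\<lambda>(r, Q).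
     let r' = vec_upd r v (r $ v + (1 - \<alpha>) * r $ u / real (out_deg E u))
     in (r', if r' $ v \<ge> \<epsilon> * real (out_deg E v) \<and> v \<notin> set Q then Q @ [v] else Q))"

text \<open>
  \<open>push_step E \<alpha> \<epsilon> \<sigma> u \<sigma>'\<close>: one pass through the while loop, popping \<open>u\<close>.  The order \<open>vs\<close> in
  which the out-neighbours are visited is arbitrary and may change from one push to the next.
\<close>

inductive push_step ::
  "('n::finite \<times> 'n) set \<Rightarrow> real \<Rightarrow> real \<Rightarrow> ('n, 'n) push_state \<Rightarrow> 'n \<Rightarrow> ('n, 'n) push_state \<Rightarrow> bool"
  for E \<alpha> \<epsilon> where
  "distinct vs \<Longrightarrow> set vs = E `` {u} \<Longrightarrow> fold (relax E \<alpha> \<epsilon> u) vs (r, Q) = (r', Q') \<Longrightarrow>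
   push_step E \<alpha> \<epsilon> (State x r (u # Q)) u
     (State (vec_upd x u (x $ u + \<alpha> * r $ u)) (vec_upd r' u 0) Q')"

inductive reachable ::
  "('n::finite \<times> 'n) set \<Rightarrow> real \<Rightarrow> real \<Rightarrow> 'n \<Rightarrow> ('n, 'n) push_state \<Rightarrow> bool"
  for E \<alpha> \<epsilon> s where
  start: "reachable E \<alpha> \<epsilon> s (initial_state s)"
| push: "reachable E \<alpha> \<epsilon> s \<sigma> \<Longrightarrow> push_step E \<alpha> \<epsilon> \<sigma> u \<sigma>' \<Longrightarrow> reachable E \<alpha> \<epsilon> s \<sigma>'"


section \<open>Epochs\<close>

definition unmark :: "'n option list \<Rightarrow> 'n list" where
  "unmark Q = List.map_filter id Q"

definition initial_marked :: "'n::finite \<Rightarrow> ('n, 'n option) push_state" where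
  "initial_marked s = State 0 (axis s 1) [Some s, None]"

text \<open>
  Popping a node performs a \<open>push_step\<close> on the queue without marker, and appends the newly queued
  nodes behind the marker; popping the marker re-appends it.
\<close>

inductive marked_step ::
  "('n::finite \<times> 'n) set \<Rightarrow> real \<Rightarrow> real \<Rightarrow> ('n, 'n option) push_state \<Rightarrow> 'n option \<Rightarrow>
   ('n, 'n option) push_state \<Rightarrow> bool"
  for E \<alpha> \<epsilon> where
  node: "push_step E \<alpha> \<epsilon> (State x r (u # unmark Q)) u (State x' r' (unmark Q @ new)) \<Longrightarrow>
    marked_step E \<alpha> \<epsilon> (State x r (Some u # Q)) (Some u) (State x' r' (Q @ map Some new))"
| marker: "marked_step E \<alpha> \<epsilon> (State x r (None # Q)) None (State x r (Q @ [None]))"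

text \<open>\<open>epoch E \<alpha> \<epsilon> \<sigma> us \<sigma>'\<close>: starting from \<open>\<sigma>\<close>, the nodes \<open>us\<close> are popped, in this order, and then
  the marker is popped.\<close>

inductive epoch ::
  "('n::finite \<times> 'n) set \<Rightarrow> real \<Rightarrow> real \<Rightarrow> ('n, 'n option) push_state \<Rightarrow> 'n list \<Rightarrow>
   ('n, 'n option) push_state \<Rightarrow> bool"
  for E \<alpha> \<epsilon> where
  finish: "marked_step E \<alpha> \<epsilon> \<sigma> None \<sigma>' \<Longrightarrow> epoch E \<alpha> \<epsilon> \<sigma> [] \<sigma>'"
| process: "marked_step E \<alpha> \<epsilon> \<sigma> (Some u) \<sigma>' \<Longrightarrow> epoch E \<alpha> \<epsilon> \<sigma>' us \<sigma>'' \<Longrightarrow>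
    epoch E \<alpha> \<epsilon> \<sigma> (u # us) \<sigma>''"

text \<open>
  The first \<open>T\<close> epochs of a run.  Epoch \<open>t\<close> (counted from \<open>0\<close>) starts in \<open>\<sigma> t\<close>, processes the
  nodes \<open>us t\<close>, and starts only if the queue without marker is nonempty.
\<close>

definition epoch_run ::
  "('n::finite \<times> 'n) set \<Rightarrow> real \<Rightarrow> real \<Rightarrow> 'n \<Rightarrow> nat \<Rightarrow> (nat \<Rightarrow> ('n, 'n option) push_state) \<Rightarrow>
   (nat \<Rightarrow> 'n list) \<Rightarrow> bool" where
  "epoch_run E \<alpha> \<epsilon> s T \<sigma> us \<longleftrightarrow>
     \<sigma> 0 = initial_marked s \<and>
     (\<forall>t<T. unmark (queue (\<sigma> t)) \<noteq> [] \<and> epoch E \<alpha> \<epsilon> (\<sigma> t) (us t) (\<sigma> (Suc t)))"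

end

theory Submission
  imports Defs
begin

text \<open>
  Throughout a run the residual satisfies \<open>\<alpha> r = b - M x\<close>. The diagonal of \<open>M\<close> is \<open>1\<close>
  because the graph has no self-loops, so the Gauss--Seidel update at \<open>u\<close> adds
  \<open>(b - M x)\<^sub>u = \<alpha> r\<^sub>u\<close> to \<open>x\<^sub>u\<close>, which is what a push at \<open>u\<close> does. Residuals are nonnegative and
  decrease only at the node being pushed, where they drop to \<open>0\<close>. Hence, except possibly for the
  initial \<open>s\<close>, a node is queued exactly when it is active, and it is queued only once.
\<close>

section \<open>Entries of the system matrix\<close>

text \<open>For square matrices a right inverse is also a left inverse, so the choice defining
  \<open>matrix_inv\<close> ranges over a nonempty set. Any chosen left inverse then equals
  \<open>B\<close> by associativity.\<close>

lemma matrix_inv_unique_right: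
  fixes A B :: "real^'n^'n"
  assumes "A ** B = mat 1"
  shows "matrix_inv A = B"
proof -
  have "B ** A = mat 1"
    using assms matrix_left_right_inverse by blast
  then have "matrix_inv A ** A = mat 1"
    using assms someI[of "\<lambda>A'. A ** A' = mat 1 \<and> A' ** A = mat 1" B]
    by (simp add: matrix_inv_def)
  then have "matrix_inv A = matrix_inv A ** (A ** B)"
    using assms by simp
  also have "\<dots> = B"
    using \<open>matrix_inv A ** A = mat 1\<close> by (simp add: matrix_mul_assoc)
  finally show ?thesis .
qed

lemma matrix_inv_deg_matrix:
  assumes "\<forall>u. out_deg E u \<ge> 1"
  shows "matrix_inv (deg_matrix E) = (\<chi> i j. if i = j then 1 / real (out_deg E i) else 0)"
proof (rule matrix_inv_unique_right)
  have nz: "out_deg E u \<noteq> 0" for u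
    using assms[rule_format, of u] by linarith
  have "(\<Sum>k\<in>UNIV. (if i = k then real (out_deg E i) else 0) *
      (if k = j then 1 / real (out_deg E k) else 0)) = (if i = j then 1 else 0)" for i j
    by (subst sum.mono_neutral_right[of UNIV "{i}"]) (auto simp: nz)
  then show "deg_matrix E ** (\<chi> i j. if i = j then 1 / real (out_deg E i) else 0) = mat 1"
    by (simp add: deg_matrix_def matrix_matrix_mult_def mat_def vec_eq_iff)
qed

lemma ppr_matrix_nth:
  assumes "\<forall>u. out_deg E u \<ge> 1"
  shows "ppr_matrix E \<alpha> $ u $ v =
    (if u = v then 1 else 0) - (if (v, u) \<in> E then (1 - \<alpha>) / real (out_deg E v) else 0)"
proof -
  have "(transpose (adj_matrix E) ** matrix_inv (deg_matrix E)) $ u $ v =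
      (\<Sum>k\<in>UNIV. (if (k, u) \<in> E then 1 else 0) * (if k = v then 1 / real (out_deg E k) else 0))"
    unfolding matrix_inv_deg_matrix[OF assms]
    by (simp add: matrix_matrix_mult_def transpose_def adj_matrix_def)
  also have "\<dots> = (if (v, u) \<in> E then 1 / real (out_deg E v) else 0)"
    by (subst sum.mono_neutral_right[of UNIV "{v}"]) auto
  finally show ?thesis
    by (simp add: ppr_matrix_def mat_def)
qed

section \<open>Single-coordinate updates\<close>

lemma vec_upd_nth [simp]: "vec_upd x u c $ i = (if i = u then c else x $ i)"
  by (simp add: vec_upd_def)

text \<open>Splitting the diagonal term off row \<open>u\<close> of the product
  \<open>M *v x\<close> leaves \<open>x $ u\<close> plus the off-diagonal sum, and the division by
  the diagonal entry disappears.\<close>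

lemma gs_update_unit_diagonal:
  assumes "M $ u $ u = 1"
  shows "gs_update M b u x = vec_upd x u (x $ u + (b - M *v x) $ u)"
proof -
  have "(M *v x) $ u = M $ u $ u * x $ u + (\<Sum>j\<in>UNIV - {u}. M $ u $ j * x $ j)"
    unfolding matrix_vector_mult_def by (simp add: sum.remove[of UNIV u])
  then show ?thesis
    using assms by (simp add: gs_update_def)
qed

text \<open>The change of \<open>x\<close> is a multiple of a basis vector, so the product changes
  by that multiple of column \<open>u\<close>.\<close>

lemma matrix_vector_mult_vec_upd:
  "(M *v vec_upd x u (x $ u + c)) $ v = (M *v x) $ v + c * M $ v $ u"
proof -
  have "vec_upd x u (x $ u + c) = x + c *\<^sub>R axis u 1"
    by (simp add: vec_eq_iff axis_def)
  then show ?thesis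
    by (simp add: matrix_vector_right_distrib matrix_vector_mult_scaleR
        matrix_vector_mult_basis column_def)
qed

section \<open>Removing the epoch marker\<close>

lemma unmark_append [simp]: "unmark (xs @ ys) = unmark xs @ unmark ys"
  by (simp add: unmark_def map_filter_def)

lemma unmark_None [simp]: "unmark (None # xs) = unmark xs"
  by (simp add: unmark_def map_filter_def)

lemma unmark_map_Some [simp]: "unmark (map Some xs) = xs"
  by (induction xs) (simp_all add: unmark_def map_filter_def)

lemma unmark_Nil [simp]: "unmark [] = []"
  by (simp add: unmark_def map_filter_def)

section \<open>The loop over the out-neighbours\<close>

text \<open>Since \<open>u\<close> is not in \<open>vs\<close>, its residual stays fixed during the
  loop and every visited node receives the same amount. Since \<open>vs\<close> is distinct, each
  node is changed only at its own visit, so the activity test made there already sees the final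
  value \<open>r'\<close>.\<close>

lemma fold_relax:
  assumes "fold (relax E \<alpha> \<epsilon> u) vs (r, Q) = (r', Q')"
    and "distinct vs" and "u \<notin> set vs"
  shows "\<forall>v. r' $ v = r $ v + (if v \<in> set vs then (1 - \<alpha>) * r $ u / real (out_deg E u) else 0)"
    and "set Q' = set Q \<union> {v \<in> set vs. \<epsilon> * real (out_deg E v) \<le> r' $ v}"
    and "distinct Q \<Longrightarrow> distinct Q'"
proof -
  have "(\<forall>v. r' $ v = r $ v + (if v \<in> set vs then (1 - \<alpha>) * r $ u / real (out_deg E u) else 0)) \<and>
    set Q' = set Q \<union> {v \<in> set vs. \<epsilon> * real (out_deg E v) \<le> r' $ v} \<and>
    (distinct Q \<longrightarrow> distinct Q')"
    using assms
  proof (induction vs arbitrary: r Q)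
    case Nil
    then show ?case by simp
  next
    case (Cons w vs)
    obtain r1 Q1 where rel: "relax E \<alpha> \<epsilon> u w (r, Q) = (r1, Q1)"
      by fastforce
    then have r1: "r1 = vec_upd r w (r $ w + (1 - \<alpha>) * r $ u / real (out_deg E u))"
      and Q1: "Q1 = (if \<epsilon> * real (out_deg E w) \<le> r1 $ w \<and> w \<notin> set Q then Q @ [w] else Q)"
      by (auto simp: relax_def Let_def)
    have IH: "\<forall>v. r' $ v = r1 $ v + (if v \<in> set vs then (1 - \<alpha>) * r1 $ u / real (out_deg E u) else 0)"
      "set Q' = set Q1 \<union> {v \<in> set vs. \<epsilon> * real (out_deg E v) \<le> r' $ v}"
      "distinct Q1 \<longrightarrow> distinct Q'"
      using Cons.IH[of r1 Q1] Cons.prems rel by auto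
    have "w \<noteq> u" "w \<notin> set vs"
      using Cons.prems by auto
    then have w: "r' $ w = r1 $ w" and u: "r1 $ u = r $ u"
      using IH(1) r1 by auto
    have "\<forall>v. r' $ v = r $ v +
        (if v \<in> set (w # vs) then (1 - \<alpha>) * r $ u / real (out_deg E u) else 0)"
      using IH(1) \<open>w \<notin> set vs\<close> u by (simp add: r1)
    moreover have "set Q' = set Q \<union> {v \<in> set (w # vs). \<epsilon> * real (out_deg E v) \<le> r' $ v}"
      using IH(2) w by (auto simp: Q1)
    moreover have "distinct Q \<longrightarrow> distinct Q'"
      using IH(3) by (auto simp: Q1)
    ultimately show ?case by blast
  qed
  then show "\<forall>v. r' $ v = r $ v + (if v \<in> set vs then (1 - \<alpha>) * r $ u / real (out_deg E u) else 0)"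
    and "set Q' = set Q \<union> {v \<in> set vs. \<epsilon> * real (out_deg E v) \<le> r' $ v}"
    and "distinct Q \<Longrightarrow> distinct Q'"
    by blast+
qed

section \<open>The invariant of a single push\<close>

locale fwd_push =
  fixes E :: "('n::finite \<times> 'n) set" and \<alpha> \<epsilon> :: real and s :: 'n
  assumes irrefl: "irrefl E"
    and deg_ge_1: "\<forall>u. out_deg E u \<ge> 1"
    and \<alpha>_less_1: "\<alpha> < 1" and \<epsilon>_pos: "0 < \<epsilon>"
begin

abbreviation "M \<equiv> ppr_matrix E \<alpha>"
abbreviation "b \<equiv> ppr_rhs \<alpha> s"

text \<open>Taking a bare residual vector allows its use on the residual between the neighbour loop
  and the reset at \<open>u\<close>, which belongs to no state.\<close>

definition active_set :: "real^'n \<Rightarrow> 'n set" where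
  "active_set r = {v. \<epsilon> * real (out_deg E v) \<le> r $ v}"

text \<open>The head of the queue is exempt from being active, to cover an inactive source \<open>s\<close> in the
  initial state.\<close>

definition push_inv :: "real^'n \<Rightarrow> real^'n \<Rightarrow> 'n list \<Rightarrow> bool" where
  "push_inv x r Q \<longleftrightarrow> \<alpha> *\<^sub>R r = b - M *v x \<and> (\<forall>v. 0 \<le> r $ v) \<and> distinct Q \<and>
     active_set r \<subseteq> set Q \<and> set (tl Q) \<subseteq> active_set r"

text \<open>Hence a node with residual 0 is never active, so a push deactivates its own
  node.\<close>

lemma threshold_pos: "0 < \<epsilon> * real (out_deg E v)"
  using \<epsilon>_pos deg_ge_1[rule_format, of v] by simp

lemma push_inv_initial: "push_inv 0 (axis s 1) [s]"
proof -
  \<comment> \<open>Only an inclusion holds: \<open>s\<close> itself is inactive when its threshold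
    exceeds 1.\<close>
  have "active_set (axis s 1) \<subseteq> {s}"
    using threshold_pos by (auto simp: active_set_def axis_def dest: leD split: if_splits)
  then show ?thesis
    by (auto simp: push_inv_def ppr_rhs_def axis_def)
qed

text \<open>The exact equality of queue and active set needs no exemption after a push: the only
  entry that may have been inactive was the head, which has just been popped.\<close>

lemma push_step_gs_update:
  assumes step: "push_step E \<alpha> \<epsilon> (State x r Q) u (State x' r' Q')" and inv: "push_inv x r Q"
  shows "x' = gs_update M b u x" and "push_inv x' r' Q'" and "set Q' = active_set r'"
proof -
  from step obtain vs r1 Q1 where Q: "Q = u # Q1" and vs: "distinct vs" "set vs = E `` {u}"
    and fold: "fold (relax E \<alpha> \<epsilon> u) vs (r, Q1) = (r1, Q')"
    and x': "x' = vec_upd x u (x $ u + \<alpha> * r $ u)" and r': "r' = vec_upd r1 u 0"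
    by (cases rule: push_step.cases) blast
  have no_loop: "(u, u) \<notin> E"
    using irrefl by (auto simp: irrefl_def)
  then have "u \<notin> set vs"
    using vs by auto
  note relax = fold_relax[OF fold vs(1) this]
  define c where "c = (1 - \<alpha>) * r $ u / real (out_deg E u)"
  have r1: "r1 $ v = r $ v + (if (u, v) \<in> E then c else 0)" for v
    using relax(1) vs(2) by (simp add: c_def)
  have res: "\<alpha> *\<^sub>R r = b - M *v x" and nonneg: "\<forall>v. 0 \<le> r $ v"
    and Q1: "distinct Q1" "u \<notin> set Q1" "active_set r \<subseteq> insert u (set Q1)" "set Q1 \<subseteq> active_set r"
    using inv by (auto simp: push_inv_def Q)
  have res_nth: "\<alpha> * r $ v = b $ v - (M *v x) $ v" for v
    using arg_cong[OF res, of "\<lambda>y. y $ v"] by simp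
  have "M $ u $ u = 1"
    using no_loop by (simp add: ppr_matrix_nth[OF deg_ge_1])
  then show "x' = gs_update M b u x"
    by (simp add: gs_update_unit_diagonal x' res_nth)
  have "0 \<le> c"
    using nonneg \<alpha>_less_1 by (simp add: c_def)
  have r1_ge: "r $ v \<le> r1 $ v" for v
    using \<open>0 \<le> c\<close> by (simp add: r1)
  \<comment> \<open>Adding \<alpha> times the residual of \<open>u\<close> to \<open>x $ u\<close>
    subtracts that multiple of column \<open>u\<close> from \<open>b - M *v x\<close>. The unit
    diagonal cancels the residual at \<open>u\<close>; the entries -(1 - \<alpha>) /
    \<open>out_deg E u\<close> at out-neighbours produce the increment \<open>c\<close>.\<close>
  have "\<alpha> * r' $ v = b $ v - (M *v x') $ v" for v
    using no_loop res_nth[of v]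
    by (auto simp: x' r' r1 c_def matrix_vector_mult_vec_upd ppr_matrix_nth[OF deg_ge_1]
        algebra_simps)
  then have res': "\<alpha> *\<^sub>R r' = b - M *v x'"
    by (simp add: vec_eq_iff)
  have nonneg': "\<forall>v. 0 \<le> r' $ v"
    using nonneg r1_ge by (auto simp: r' intro: order_trans)
  have active': "active_set r' = active_set r1 - {u}"
    using threshold_pos[of u] by (auto simp: active_set_def r')
  \<comment> \<open>Queued nodes stay active because residuals only grow in the loop, and a node
    becoming active has gained mass, hence is an out-neighbour. Without a self-loop \<open>u\<close>
    is not queued again.\<close>
  have "set Q' = set Q1 \<union> (E `` {u} \<inter> active_set r1)"
    using relax(2) vs(2) by (auto simp: active_set_def)
  moreover have "active_set r \<subseteq> active_set r1"
    using r1_ge by (auto simp: active_set_def intro: order_trans)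
  moreover have "active_set r1 \<subseteq> active_set r \<union> E `` {u}"
    by (auto simp: active_set_def r1 split: if_splits)
  ultimately show queue': "set Q' = active_set r'"
    using Q1 no_loop unfolding active' by blast
  have "set (tl Q') \<subseteq> set Q'"
    by (cases Q') auto
  then show "push_inv x' r' Q'"
    using res' nonneg' relax(3) Q1(1) queue' by (auto simp: push_inv_def)
qed

lemma reachable_push_inv:
  assumes "reachable E \<alpha> \<epsilon> s \<sigma>"
  shows "push_inv (est \<sigma>) (res \<sigma>) (queue \<sigma>)"
    and "set (queue \<sigma>) = active_set (res \<sigma>) \<or> \<sigma> = initial_state s"
proof -
  have "push_inv (est \<sigma>) (res \<sigma>) (queue \<sigma>) \<and>
    (set (queue \<sigma>) = active_set (res \<sigma>) \<or> \<sigma> = initial_state s)"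
    using assms
  proof induction
    case start
    show ?case by (simp add: push_inv_initial initial_state_def)
  next
    case (push \<sigma> u \<sigma>')
    then show ?case
      using push_step_gs_update(2,3)[of "est \<sigma>" "res \<sigma>" "queue \<sigma>" u "est \<sigma>'" "res \<sigma>'" "queue \<sigma>'"]
      by simp
  qed
  then show "push_inv (est \<sigma>) (res \<sigma>) (queue \<sigma>)"
    and "set (queue \<sigma>) = active_set (res \<sigma>) \<or> \<sigma> = initial_state s"
    by blast+
qed

section \<open>Epochs as super-iterations\<close>

text \<open>The induction needs a state in mid-epoch: \<open>P\<close> still waits before the
  marker, while \<open>N\<close> was queued during the epoch. At the start of an epoch
  \<open>N\<close> is empty. A single push already makes the queue exactly the active set, so this
  has to be assumed only when \<open>P\<close> is empty.\<close>

lemma epoch_gauss_seidel: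
  assumes "epoch E \<alpha> \<epsilon> \<sigma> us \<sigma>'"
    and "queue \<sigma> = map Some P @ None # map Some N"
    and "push_inv (est \<sigma>) (res \<sigma>) (P @ N)"
  obtains N' where "us = P" "queue \<sigma>' = map Some N' @ [None]"
    "push_inv (est \<sigma>') (res \<sigma>') N'" "est \<sigma>' = fold (gs_update M b) us (est \<sigma>)"
    "P \<noteq> [] \<or> set N = active_set (res \<sigma>) \<Longrightarrow> set N' = active_set (res \<sigma>')"
proof -
  have "\<exists>N'. us = P \<and> queue \<sigma>' = map Some N' @ [None] \<and>
    push_inv (est \<sigma>') (res \<sigma>') N' \<and> est \<sigma>' = fold (gs_update M b) us (est \<sigma>) \<and>
    (P \<noteq> [] \<or> set N = active_set (res \<sigma>) \<longrightarrow> set N' = active_set (res \<sigma>'))"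
    using assms
  proof (induction arbitrary: P N)
    case (finish \<sigma> \<sigma>')
    then obtain x r Q where \<sigma>: "\<sigma> = State x r (None # Q)" "\<sigma>' = State x r (Q @ [None])"
      by (cases rule: marked_step.cases) blast
    then have "P = []" "Q = map Some N"
      using finish.prems(1) by (cases P; simp)+
    then show ?case
      using finish.prems \<sigma> by auto
  next
    case (process \<sigma> u \<sigma>1 us \<sigma>')
    from process.hyps(1) obtain x r Q x1 r1 new where \<sigma>: "\<sigma> = State x r (Some u # Q)"
        "\<sigma>1 = State x1 r1 (Q @ map Some new)"
      and push: "push_step E \<alpha> \<epsilon> (State x r (u # unmark Q)) u (State x1 r1 (unmark Q @ new))"
      by (cases rule: marked_step.cases) blast
    obtain P1 where P: "P = u # P1" and Q: "Q = map Some P1 @ None # map Some N"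
      using process.prems(1) \<sigma>(1) by (cases P) auto
    have "push_inv x r (u # unmark Q)"
      using process.prems(2) \<sigma>(1) by (simp add: P Q)
    note step = push_step_gs_update[OF push this]
    have "queue \<sigma>1 = map Some P1 @ None # map Some (N @ new)"
      and "push_inv (est \<sigma>1) (res \<sigma>1) (P1 @ N @ new)"
      using step(2) by (simp_all add: \<sigma>(2) Q)
    from process.IH[OF this] obtain N' where N': "us = P1" "queue \<sigma>' = map Some N' @ [None]"
      "push_inv (est \<sigma>') (res \<sigma>') N'" "est \<sigma>' = fold (gs_update M b) us (est \<sigma>1)"
      "P1 \<noteq> [] \<or> set (N @ new) = active_set (res \<sigma>1) \<longrightarrow> set N' = active_set (res \<sigma>')"
      by blast
    \<comment> \<open>If \<open>P1\<close> is empty, \<open>N @ new\<close> is the entire queue,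
      which the push has just made equal to the active set; otherwise the induction hypothesis
      applies outright.\<close>
    have "set N' = active_set (res \<sigma>')"
      using N'(5) step(3) by (cases "P1 = []") (simp_all add: Q \<sigma>(2))
    then show ?case
      using N' step(1) by (auto simp: P \<sigma>)
  qed
  then show ?thesis
    using that by blast
qed

lemma epoch_run_gauss_seidel:
  assumes run: "epoch_run E \<alpha> \<epsilon> s T \<sigma> us"
  shows "gauss_seidel M b 0 T (\<lambda>t. set (us t)) us (\<lambda>t. est (\<sigma> t))"
    and "t < T \<Longrightarrow> set (us t) = set (unmark (queue (\<sigma> t)))"
    and "t < T \<Longrightarrow> 0 < t \<or> active E \<epsilon> (\<sigma> 0) s \<Longrightarrow> set (us t) = {u. active E \<epsilon> (\<sigma> t) u}"
proof -
  have \<sigma>0: "\<sigma> 0 = State 0 (axis s 1) [Some s, None]"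
    using run by (simp add: epoch_run_def initial_marked_def)
  have epoch: "epoch E \<alpha> \<epsilon> (\<sigma> t) (us t) (\<sigma> (Suc t))" and nonempty: "unmark (queue (\<sigma> t)) \<noteq> []"
    if "t < T" for t
    using run that by (auto simp: epoch_run_def)
  have start: "\<exists>P. queue (\<sigma> t) = map Some P @ [None] \<and> push_inv (est (\<sigma> t)) (res (\<sigma> t)) P \<and>
      (0 < t \<longrightarrow> set P = active_set (res (\<sigma> t)))" if "t \<le> T" for t
    using that
  proof (induction t)
    case 0
    show ?case
      by (rule exI[of _ "[s]"]) (simp add: \<sigma>0 push_inv_initial)
  next
    case (Suc t)
    then obtain P where P: "queue (\<sigma> t) = map Some P @ [None]"
      "push_inv (est (\<sigma> t)) (res (\<sigma> t)) P"
      by auto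
    \<comment> \<open>An epoch starts only on a nonempty queue, so it contains a push, and the next
      queue is exactly the active set.\<close>
    have "P \<noteq> []"
      using nonempty[of t] Suc.prems P(1) by auto
    with P epoch_gauss_seidel[OF epoch[of t], of P "[]"] Suc.prems show ?case
      by (metis Suc_le_lessD append_Nil2 list.map(1))
  qed
  have main: "distinct (us t) \<and> est (\<sigma> (Suc t)) = fold (gs_update M b) (us t) (est (\<sigma> t)) \<and>
      unmark (queue (\<sigma> t)) = us t \<and> (0 < t \<longrightarrow> set (us t) = active_set (res (\<sigma> t)))"
    if t: "t < T" for t
  proof -
    obtain P where P: "queue (\<sigma> t) = map Some P @ [None]"
      "push_inv (est (\<sigma> t)) (res (\<sigma> t)) P" "0 < t \<longrightarrow> set P = active_set (res (\<sigma> t))"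
      using start[of t] t by auto
    have "us t = P" "est (\<sigma> (Suc t)) = fold (gs_update M b) (us t) (est (\<sigma> t))"
      using epoch_gauss_seidel[OF epoch[OF t], of P "[]"] P by auto
    moreover have "distinct P"
      using P(2) by (simp add: push_inv_def)
    ultimately show ?thesis
      using P by simp
  qed
  show "gauss_seidel M b 0 T (\<lambda>t. set (us t)) us (\<lambda>t. est (\<sigma> t))"
    using main \<sigma>0 by (auto simp: gauss_seidel_def)
  show "set (us t) = set (unmark (queue (\<sigma> t)))" if "t < T"
    using main that by simp
  show "set (us t) = {u. active E \<epsilon> (\<sigma> t) u}" if t: "t < T" and or: "0 < t \<or> active E \<epsilon> (\<sigma> 0) s"
  proof (cases "t = 0")
    case True
    have "us 0 = [s]"
      using main[of 0] t True \<sigma>0 by (simp add: unmark_def map_filter_def)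
    \<comment> \<open>Epoch 0 is the one place where the activity of \<open>s\<close> comes from the
      hypothesis; the invariant gives the other inclusion.\<close>
    moreover have "active_set (axis s 1) = {s}"
      using push_inv_initial or True \<sigma>0
      by (auto simp: push_inv_def active_set_def active_def)
    ultimately show ?thesis
      using True \<sigma>0 by (simp add: active_set_def active_def)
  next
    case False
    then show ?thesis
      using main[OF t] by (simp add: active_set_def active_def)
  qed
qed

end

theorem theorem1:
  fixes E :: "('n::finite \<times> 'n) set" and \<alpha> \<epsilon> :: real and s :: 'n
  assumes "irrefl E"
    and "\<forall>u. out_deg E u \<ge> 1"
    and "0 < \<alpha>" and "\<alpha> < 1" and "0 < \<epsilon>"
  shows
    "(\<forall>\<sigma> u \<sigma>'. reachable E \<alpha> \<epsilon> s \<sigma> \<longrightarrow> push_step E \<alpha> \<epsilon> \<sigma> u \<sigma>' \<longrightarrow>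
        est \<sigma>' = gs_update (ppr_matrix E \<alpha>) (ppr_rhs \<alpha> s) u (est \<sigma>) \<and>
        (active E \<epsilon> \<sigma> u \<or> \<sigma> = initial_state s)) \<and>
     (\<forall>T \<sigma> us. epoch_run E \<alpha> \<epsilon> s T \<sigma> us \<longrightarrow>
        gauss_seidel (ppr_matrix E \<alpha>) (ppr_rhs \<alpha> s) 0 T (\<lambda>t. set (us t)) us (\<lambda>t. est (\<sigma> t)) \<and>
        (\<forall>t<T. set (us t) = set (unmark (queue (\<sigma> t))) \<and>
           (0 < t \<or> active E \<epsilon> (\<sigma> 0) s \<longrightarrow> set (us t) = {u. active E \<epsilon> (\<sigma> t) u})))"
proof -
  interpret fwd_push E \<alpha> \<epsilon> s
    using assms by unfold_locales auto
  have push: "est \<sigma>' = gs_update (ppr_matrix E \<alpha>) (ppr_rhs \<alpha> s) u (est \<sigma>) \<and>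
      (active E \<epsilon> \<sigma> u \<or> \<sigma> = initial_state s)"
    if "reachable E \<alpha> \<epsilon> s \<sigma>" and step: "push_step E \<alpha> \<epsilon> \<sigma> u \<sigma>'" for \<sigma> u \<sigma>'
  proof -
    note inv = reachable_push_inv[OF that(1)]
    have "est \<sigma>' = gs_update (ppr_matrix E \<alpha>) (ppr_rhs \<alpha> s) u (est \<sigma>)"
      using push_step_gs_update(1)[of "est \<sigma>" "res \<sigma>" "queue \<sigma>" u "est \<sigma>'" "res \<sigma>'" "queue \<sigma>'"]
        step inv(1) by simp
    \<comment> \<open>Queue membership gives activity in every reachable state but the initial
      one.\<close>
    moreover have "u \<in> set (queue \<sigma>)"
      using step by (cases rule: push_step.cases) simp
    ultimately show ?thesis
      using inv(2) by (auto simp: active_set_def active_def)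
  qed
  show ?thesis
    using push epoch_run_gauss_seidel by blast
qed

end
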